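(* Let a formal deformation, to lowest order in $\hbar$, of the differential calculus on a smooth manifold $M$ be given (see context), with associated Poisson bracket $\{\ ,\ \}$ and associated map $\gamma:C^\infty(M)\times\Omega^1(M)\to\Omega^1(M)$. Then for every $\tau\in\Omega^1(M)$ the map $\gamma(-,\tau)$ is a derivation on $C^\infty(M)$, i.e. $\gamma(xy,\tau)=x\,\gamma(y,\tau)+\gamma(x,\tau)\,y$ for all $x,y\in C^\infty(M)$, and $$\gamma(x,\tau\,y)=\gamma(x,\tau)\,y+\tau\,\{x,y\}\qquad \forall x,y\in C^\infty(M),\ \tau\in\Omega^1(M)$$ (that is, $\gamma$ is a preconnection). Moreover $\gamma$ is compatible with the Poisson structure in the sense that $$\mathrm{d}\{x,y\}=\gamma(x,\mathrm{d}y)-\gamma(y,\mathrm{d}x)\qquad\forall x,y\in C^\infty(M).$$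
   Context: $\Omega^n(M)$ denotes the $n$-forms on $M$, $\Omega^0(M)=C^\infty(M)$. A formal deformation of the differential calculus on $M$ to lowest order in $\hbar$ consists of the following maps depending on a parameter $\hbar$ and admitting power series expansions in $\hbar$ (extended linearly in $\hbar$; $O(\hbar^k)$ denotes terms of order at least $k$ in $\hbar$): (i) an associative product $\bullet$ on $C^\infty(M)$ with $x\bullet y=xy+O(\hbar)$ and $x\bullet y-y\bullet x=\hbar\{x,y\}+O(\hbar^2)$ (so $\{\ ,\ \}$ is a Poisson bracket); (ii) products $x\bullet\tau$ and $\tau\bullet x$ for $x\in C^\infty(M)$, $\tau\in\Omega^1(M)$, both equal to $x\tau+O(\hbar)$, making $\Omega^1(M)$ a bimodule to order $O(\hbar^2)$: $(x\bullet y)\bullet\tau-x\bullet(y\bullet\tau)=O(\hbar^2)$, $\tau\bullet(x\bullet y)-(\tau\bullet x)\bullet y=O(\hbar^2)$, $(x\bullet\tau)\bullet y-x\bullet(\tau\bullet y)=O(\hbar^2)$; (iii) a deformed exterior product $\wedge_\bullet$ on forms, with $\tau\wedge_\bullet\eta=\tau\wedge\eta+O(\hbar)$, associative to $O(\hbar^2)$ (written $\bullet$ when one of the factors is a function); (iv) an operator $\mathrm{d}^\bullet:\Omega^n(M)\to\Omega^{n+1}(M)$ with $\mathrm{d}^\bullet=\mathrm{d}+O(\hbar)$ which is a graded derivation to order $O(\hbar^2)$: $\mathrm{d}^\bullet(\xi\wedge_\bullet\eta)=\mathrm{d}^\bullet\xi\wedge_\bullet\eta+(-1)^{\deg\xi}\xi\wedge_\bullet\mathrm{d}^\bullet\eta+O(\hbar^2)$.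 The map $\gamma$ is defined by $x\bullet\tau-\tau\bullet x=\hbar\,\gamma(x,\tau)+O(\hbar^2)$. *)

theory Defs
  imports "HOL-Analysis.Analysis" "HOL-Combinatorics.Permutations" "HOL-Library.Function_Algebras"
begin

text \<open>
  Functions are added, subtracted and multiplied pointwise (\<^theory>\<open>HOL-Library.Function_Algebras\<close>).
\<close>

section \<open>Smooth manifolds\<close>

text \<open>
  Points of $\mathbb{R}^n$ are functions \<open>nat \<Rightarrow> real\<close> vanishing at all indices \<open>\<ge> n\<close>, as in
  \<^const>\<open>Euclidean_space\<close>; \<open>n = 0\<close> is allowed.
\<close>

definition partial_deriv :: "nat \<Rightarrow> ((nat \<Rightarrow> real) \<Rightarrow> real) \<Rightarrow> (nat \<Rightarrow> real) \<Rightarrow> real" where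
  "partial_deriv i f x = deriv (\<lambda>t. f (x(i := t))) (x i)"

text \<open>The class $C^k$ on an open set \<open>U\<close> of $\mathbb{R}^n$.\<close>

fun Ck_on :: "nat \<Rightarrow> nat \<Rightarrow> (nat \<Rightarrow> real) set \<Rightarrow> ((nat \<Rightarrow> real) \<Rightarrow> real) \<Rightarrow> bool" where
  "Ck_on n 0 U f \<longleftrightarrow> continuous_map (subtopology (Euclidean_space n) U) euclideanreal f"
| "Ck_on n (Suc k) U f \<longleftrightarrow>
     continuous_map (subtopology (Euclidean_space n) U) euclideanreal f \<and>
     (\<forall>i<n. (\<forall>x\<in>U. (\<lambda>t. f (x(i := t))) field_differentiable at (x i)) \<and>
            Ck_on n k U (partial_deriv i f))"

definition smooth_on :: "nat \<Rightarrow> (nat \<Rightarrow> real) set \<Rightarrow> ((nat \<Rightarrow> real) \<Rightarrow> real) \<Rightarrow> bool" where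
  "smooth_on n U f \<longleftrightarrow> (\<forall>k. Ck_on n k U f)"

text \<open>A chart is a pair of its domain and its coordinate map.\<close>

record 'a manifold =
  points :: "'a topology"
  mdim :: nat
  atlas :: "('a set \<times> ('a \<Rightarrow> nat \<Rightarrow> real)) set"

definition smooth_manifold :: "'a manifold \<Rightarrow> bool" where
  "smooth_manifold M \<longleftrightarrow>
     Hausdorff_space (points M) \<and> second_countable (points M) \<and>
     (\<Union>(U, \<phi>)\<in>atlas M. U) = topspace (points M) \<and>
     (\<forall>(U, \<phi>)\<in>atlas M.
        openin (points M) U \<and> openin (Euclidean_space (mdim M)) (\<phi> ` U) \<and>
        homeomorphic_map (subtopology (points M) U)
          (subtopology (Euclidean_space (mdim M)) (\<phi> ` U)) \<phi>) \<and>
     (\<forall>(U, \<phi>)\<in>atlas M. \<forall>(V, \<psi>)\<in>atlas M. \<forall>i<mdim M.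
        smooth_on (mdim M) (\<phi> ` (U \<inter> V)) (\<lambda>y. \<psi> (inv_into U \<phi> y) i))"

text \<open>
  Functions, vector fields and forms on \<open>M\<close> are total functions in HOL; they are normalised to be
  zero outside the intended domain, so that equality in HOL is the intended equality.
\<close>

definition C_inf :: "'a manifold \<Rightarrow> ('a \<Rightarrow> real) set" where
  "C_inf M = {f. (\<forall>p. p \<notin> topspace (points M) \<longrightarrow> f p = 0) \<and>
                 (\<forall>(U, \<phi>)\<in>atlas M. smooth_on (mdim M) (\<phi> ` U) (\<lambda>y. f (inv_into U \<phi> y)))}"

section \<open>Tangent vectors and differential forms\<close>

text \<open>Tangent vectors at \<open>p\<close> are the derivations at \<open>p\<close> of the algebra of smooth functions.\<close>

type_synonym 'a tangent_vector = "('a \<Rightarrow> real) \<Rightarrow> real"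

definition tangent_space :: "'a manifold \<Rightarrow> 'a \<Rightarrow> 'a tangent_vector set" where
  "tangent_space M p = {v.
     (\<forall>f. f \<notin> C_inf M \<longrightarrow> v f = 0) \<and>
     (\<forall>f\<in>C_inf M. \<forall>g\<in>C_inf M. \<forall>a b. v (\<lambda>q. a * f q + b * g q) = a * v f + b * v g) \<and>
     (\<forall>f\<in>C_inf M. \<forall>g\<in>C_inf M. v (f * g) = f p * v g + v f * g p)}"

definition vector_fields :: "'a manifold \<Rightarrow> ('a \<Rightarrow> 'a tangent_vector) set" where
  "vector_fields M = {X.
     (\<forall>p\<in>topspace (points M). X p \<in> tangent_space M p) \<and>
     (\<forall>p. p \<notin> topspace (points M) \<longrightarrow> X p = 0) \<and>
     (\<forall>f\<in>C_inf M. (\<lambda>p. X p f) \<in> C_inf M)}"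

definition lie_bracket ::
    "('a \<Rightarrow> 'a tangent_vector) \<Rightarrow> ('a \<Rightarrow> 'a tangent_vector) \<Rightarrow> 'a \<Rightarrow> 'a tangent_vector" where
  "lie_bracket X Y p f = X p (\<lambda>q. Y q f) - Y p (\<lambda>q. X q f)"

text \<open>
  A \<open>k\<close>-form assigns to each point \<open>p\<close> an alternating \<open>k\<close>-linear form on the tangent space at \<open>p\<close>,
  smoothly in \<open>p\<close>; the \<open>k\<close> arguments are given as a list.
\<close>

type_synonym 'a form = "'a \<times> 'a tangent_vector list \<Rightarrow> real"

definition forms :: "'a manifold \<Rightarrow> nat \<Rightarrow> 'a form set" where
  "forms M k = {\<omega>.
     (\<forall>p vs. \<not> (p \<in> topspace (points M) \<and> length vs = k \<and> set vs \<subseteq> tangent_space M p)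
        \<longrightarrow> \<omega> (p, vs) = 0) \<and>
     (\<forall>p\<in>topspace (points M). \<forall>vs. length vs = k \<and> set vs \<subseteq> tangent_space M p \<longrightarrow>
        (\<forall>i<k. \<forall>v\<in>tangent_space M p. \<forall>w\<in>tangent_space M p. \<forall>a b.
           \<omega> (p, vs[i := (\<lambda>f. a * v f + b * w f)]) = a * \<omega> (p, vs[i := v]) + b * \<omega> (p, vs[i := w])) \<and>
        (\<forall>i<k. \<forall>j<k. i \<noteq> j \<and> vs ! i = vs ! j \<longrightarrow> \<omega> (p, vs) = 0)) \<and>
     (\<forall>Xs. length Xs = k \<and> set Xs \<subseteq> vector_fields M \<longrightarrow>
        (\<lambda>p. \<omega> (p, map (\<lambda>X. X p) Xs)) \<in> C_inf M)}"

text \<open>The identification of smooth functions with 0-forms.\<close>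

definition zero_form :: "('a \<Rightarrow> real) \<Rightarrow> 'a form" where
  "zero_form x = (\<lambda>(p, vs). if vs = [] then x p else 0)"

text \<open>The classical bimodule structure: $x\tau = \tau x$.\<close>

definition fmult :: "('a \<Rightarrow> real) \<Rightarrow> 'a form \<Rightarrow> 'a form" where
  "fmult x \<tau> = (\<lambda>(p, vs). x p * \<tau> (p, vs))"

definition wedge :: "nat \<Rightarrow> nat \<Rightarrow> 'a form \<Rightarrow> 'a form \<Rightarrow> 'a form" where
  "wedge k l \<omega> \<eta> = (\<lambda>(p, vs).
     if length vs = k + l then
       (\<Sum>\<sigma> | \<sigma> permutes {..<k + l}. of_int (sign \<sigma>) *
          \<omega> (p, map (\<lambda>i. vs ! \<sigma> i) [0..<k]) * \<eta> (p, map (\<lambda>i. vs ! \<sigma> i) [k..<k + l]))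
       / (fact k * fact l)
     else 0)"

definition remove_nth :: "nat \<Rightarrow> 'b list \<Rightarrow> 'b list" where
  "remove_nth i xs = take i xs @ drop (Suc i) xs"

text \<open>
  The exterior derivative, by the invariant formula
  \[ d\omega(X_0,\dots,X_k) = \sum_i (-1)^i X_i(\omega(X_0,\dots,\hat X_i,\dots,X_k))
       + \sum_{i<j} (-1)^{i+j} \omega([X_i,X_j],X_0,\dots,\hat X_i,\dots,\hat X_j,\dots,X_k). \]
  Its value at \<open>p\<close> depends only on the vectors $X_i(p)$, and every tangent vector at \<open>p\<close> extends to a
  vector field on \<open>M\<close>; so the value on given tangent vectors is computed with an arbitrary choice of
  extensions.
\<close>

definition ext_deriv :: "'a manifold \<Rightarrow> nat \<Rightarrow> 'a form \<Rightarrow> 'a form" where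
  "ext_deriv M k \<omega> = (\<lambda>(p, vs).
     if p \<in> topspace (points M) \<and> length vs = Suc k \<and> set vs \<subseteq> tangent_space M p then
       let Xs = (SOME Xs. set Xs \<subseteq> vector_fields M \<and> map (\<lambda>X. X p) Xs = vs) in
         (\<Sum>i\<le>k. (-1) ^ i * (Xs ! i) p (\<lambda>q. \<omega> (q, map (\<lambda>X. X q) (remove_nth i Xs)))) +
         (\<Sum>j\<le>k. \<Sum>i<j. (-1) ^ (i + j) *
            \<omega> (p, lie_bracket (Xs ! i) (Xs ! j) p # map (\<lambda>X. X p) (remove_nth i (remove_nth j Xs))))
     else 0)"

section \<open>Real linear maps between spaces of real-valued functions\<close>

definition linear_map :: "('b \<Rightarrow> real) set \<Rightarrow> ('c \<Rightarrow> real) set \<Rightarrow> (('b \<Rightarrow> real) \<Rightarrow> 'c \<Rightarrow> real) \<Rightarrow> bool" where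
  "linear_map S T F \<longleftrightarrow> (\<forall>u\<in>S. F u \<in> T) \<and>
     (\<forall>u\<in>S. \<forall>v\<in>S. \<forall>a b. F (\<lambda>z. a * u z + b * v z) = (\<lambda>z. a * F u z + b * F v z))"

definition bilinear_map ::
    "('b \<Rightarrow> real) set \<Rightarrow> ('c \<Rightarrow> real) set \<Rightarrow> ('d \<Rightarrow> real) set \<Rightarrow>
     (('b \<Rightarrow> real) \<Rightarrow> ('c \<Rightarrow> real) \<Rightarrow> 'd \<Rightarrow> real) \<Rightarrow> bool" where
  "bilinear_map S T V F \<longleftrightarrow>
     (\<forall>u\<in>S. linear_map T V (F u)) \<and> (\<forall>v\<in>T. linear_map S V (\<lambda>u. F u v))"

section \<open>Formal power series in $\hbar$\<close>

text \<open>
  The series $\sum_n \hbar^n u_n$ is the sequence \<open>u\<close> of its coefficients. A map depending on $\hbar$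
  is likewise the sequence of its coefficients, which are maps between the undeformed spaces.
\<close>

type_synonym 'b series = "nat \<Rightarrow> 'b"

text \<open>\<open>hterm n u\<close> is $\hbar^n u$; in particular \<open>hterm 0 u\<close> is \<open>u\<close> as a constant series.\<close>

definition hterm :: "nat \<Rightarrow> 'b \<Rightarrow> ('b::zero) series" where
  "hterm n u = (\<lambda>m. if m = n then u else 0)"

text \<open>\<open>eq_mod_hbar k u v\<close> is $u = v + O(\hbar^k)$.\<close>

definition eq_mod_hbar :: "nat \<Rightarrow> 'b series \<Rightarrow> 'b series \<Rightarrow> bool" where
  "eq_mod_hbar k u v \<longleftrightarrow> (\<forall>n<k. u n = v n)"

text \<open>Application of maps depending on $\hbar$, extended $\hbar$-linearly to series.\<close>

definition happly :: "('b \<Rightarrow> 'c) series \<Rightarrow> 'b series \<Rightarrow> ('c::comm_monoid_add) series" where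
  "happly F u = (\<lambda>n. \<Sum>i\<le>n. F i (u (n - i)))"

definition happly2 ::
    "('b \<Rightarrow> 'c \<Rightarrow> 'd) series \<Rightarrow> 'b series \<Rightarrow> 'c series \<Rightarrow> ('d::comm_monoid_add) series" where
  "happly2 F u v = (\<lambda>n. \<Sum>i\<le>n. \<Sum>j\<le>n - i. F i (u j) (v (n - i - j)))"

section \<open>Formal deformations of the differential calculus\<close>

text \<open>
  The data are: \<open>B\<close> for $x \bullet y$; \<open>L\<close> for $x \bullet \tau$; \<open>R\<close> for $\tau \bullet x$;
  \<open>W p q\<close> for the deformed exterior product of a \<open>p\<close>-form and a \<open>q\<close>-form; and \<open>D p\<close> for the deformed
  exterior derivative on \<open>p\<close>-forms.
\<close>

definition deformed_product ::
    "'a manifold \<Rightarrow> (('a \<Rightarrow> real) \<Rightarrow> ('a \<Rightarrow> real) \<Rightarrow> 'a \<Rightarrow> real) series \<Rightarrow> bool" where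
  "deformed_product M B \<longleftrightarrow>
     (\<forall>n. bilinear_map (C_inf M) (C_inf M) (C_inf M) (B n)) \<and>
     (\<forall>x\<in>C_inf M. \<forall>y\<in>C_inf M.
        eq_mod_hbar 1 (happly2 B (hterm 0 x) (hterm 0 y)) (hterm 0 (x * y))) \<and>
     (\<forall>x\<in>C_inf M. \<forall>y\<in>C_inf M. \<forall>z\<in>C_inf M.
        happly2 B (happly2 B (hterm 0 x) (hterm 0 y)) (hterm 0 z) =
        happly2 B (hterm 0 x) (happly2 B (hterm 0 y) (hterm 0 z)))"

definition deformed_bimodule ::
    "'a manifold \<Rightarrow> (('a \<Rightarrow> real) \<Rightarrow> ('a \<Rightarrow> real) \<Rightarrow> 'a \<Rightarrow> real) series \<Rightarrow>
     (('a \<Rightarrow> real) \<Rightarrow> 'a form \<Rightarrow> 'a form) series \<Rightarrow> ('a form \<Rightarrow> ('a \<Rightarrow> real) \<Rightarrow> 'a form) series \<Rightarrow> bool" where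
  "deformed_bimodule M B L R \<longleftrightarrow>
     (\<forall>n. bilinear_map (C_inf M) (forms M 1) (forms M 1) (L n)) \<and>
     (\<forall>n. bilinear_map (forms M 1) (C_inf M) (forms M 1) (R n)) \<and>
     (\<forall>x\<in>C_inf M. \<forall>\<tau>\<in>forms M 1.
        eq_mod_hbar 1 (happly2 L (hterm 0 x) (hterm 0 \<tau>)) (hterm 0 (fmult x \<tau>)) \<and>
        eq_mod_hbar 1 (happly2 R (hterm 0 \<tau>) (hterm 0 x)) (hterm 0 (fmult x \<tau>))) \<and>
     (\<forall>x\<in>C_inf M. \<forall>y\<in>C_inf M. \<forall>\<tau>\<in>forms M 1.
        eq_mod_hbar 2 (happly2 L (happly2 B (hterm 0 x) (hterm 0 y)) (hterm 0 \<tau>))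
                      (happly2 L (hterm 0 x) (happly2 L (hterm 0 y) (hterm 0 \<tau>))) \<and>
        eq_mod_hbar 2 (happly2 R (hterm 0 \<tau>) (happly2 B (hterm 0 x) (hterm 0 y)))
                      (happly2 R (happly2 R (hterm 0 \<tau>) (hterm 0 x)) (hterm 0 y)) \<and>
        eq_mod_hbar 2 (happly2 R (happly2 L (hterm 0 x) (hterm 0 \<tau>)) (hterm 0 y))
                      (happly2 L (hterm 0 x) (happly2 R (hterm 0 \<tau>) (hterm 0 y))))"

definition deformed_wedge ::
    "'a manifold \<Rightarrow> (('a \<Rightarrow> real) \<Rightarrow> ('a \<Rightarrow> real) \<Rightarrow> 'a \<Rightarrow> real) series \<Rightarrow>
     (('a \<Rightarrow> real) \<Rightarrow> 'a form \<Rightarrow> 'a form) series \<Rightarrow> ('a form \<Rightarrow> ('a \<Rightarrow> real) \<Rightarrow> 'a form) series \<Rightarrow>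
     (nat \<Rightarrow> nat \<Rightarrow> ('a form \<Rightarrow> 'a form \<Rightarrow> 'a form) series) \<Rightarrow> bool" where
  "deformed_wedge M B L R W \<longleftrightarrow>
     (\<forall>p q n. bilinear_map (forms M p) (forms M q) (forms M (p + q)) (W p q n)) \<and>
     (\<forall>p q. \<forall>\<tau>\<in>forms M p. \<forall>\<eta>\<in>forms M q.
        eq_mod_hbar 1 (happly2 (W p q) (hterm 0 \<tau>) (hterm 0 \<eta>)) (hterm 0 (wedge p q \<tau> \<eta>))) \<and>
     (\<forall>p q r. \<forall>\<tau>\<in>forms M p. \<forall>\<eta>\<in>forms M q. \<forall>\<zeta>\<in>forms M r.
        eq_mod_hbar 2 (happly2 (W (p + q) r) (happly2 (W p q) (hterm 0 \<tau>) (hterm 0 \<eta>)) (hterm 0 \<zeta>))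
                      (happly2 (W p (q + r)) (hterm 0 \<tau>) (happly2 (W q r) (hterm 0 \<eta>) (hterm 0 \<zeta>)))) \<and>
     \<comment> \<open>with functions as 0-forms, this extends the products \<open>B\<close>, \<open>L\<close> and \<open>R\<close>\<close>
     (\<forall>n. \<forall>x\<in>C_inf M.
        (\<forall>y\<in>C_inf M. W 0 0 n (zero_form x) (zero_form y) = zero_form (B n x y)) \<and>
        (\<forall>\<tau>\<in>forms M 1. W 0 1 n (zero_form x) \<tau> = L n x \<tau> \<and> W 1 0 n \<tau> (zero_form x) = R n \<tau> x))"

definition deformed_derivative ::
    "'a manifold \<Rightarrow> (nat \<Rightarrow> nat \<Rightarrow> ('a form \<Rightarrow> 'a form \<Rightarrow> 'a form) series) \<Rightarrow>
     (nat \<Rightarrow> ('a form \<Rightarrow> 'a form) series) \<Rightarrow> bool" where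
  "deformed_derivative M W D \<longleftrightarrow>
     (\<forall>p n. linear_map (forms M p) (forms M (Suc p)) (D p n)) \<and>
     (\<forall>p. \<forall>\<xi>\<in>forms M p. eq_mod_hbar 1 (happly (D p) (hterm 0 \<xi>)) (hterm 0 (ext_deriv M p \<xi>))) \<and>
     (\<forall>p q. \<forall>\<xi>\<in>forms M p. \<forall>\<eta>\<in>forms M q.
        eq_mod_hbar 2 (happly (D (p + q)) (happly2 (W p q) (hterm 0 \<xi>) (hterm 0 \<eta>)))
          (happly2 (W (Suc p) q) (happly (D p) (hterm 0 \<xi>)) (hterm 0 \<eta>) +
           (-1) ^ p * happly2 (W p (Suc q)) (hterm 0 \<xi>) (happly (D q) (hterm 0 \<eta>))))"

definition formal_deformation ::
    "'a manifold \<Rightarrow> (('a \<Rightarrow> real) \<Rightarrow> ('a \<Rightarrow> real) \<Rightarrow> 'a \<Rightarrow> real) series \<Rightarrow>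
     (('a \<Rightarrow> real) \<Rightarrow> 'a form \<Rightarrow> 'a form) series \<Rightarrow> ('a form \<Rightarrow> ('a \<Rightarrow> real) \<Rightarrow> 'a form) series \<Rightarrow>
     (nat \<Rightarrow> nat \<Rightarrow> ('a form \<Rightarrow> 'a form \<Rightarrow> 'a form) series) \<Rightarrow>
     (nat \<Rightarrow> ('a form \<Rightarrow> 'a form) series) \<Rightarrow> bool" where
  "formal_deformation M B L R W D \<longleftrightarrow>
     deformed_product M B \<and> deformed_bimodule M B L R \<and>
     deformed_wedge M B L R W \<and> deformed_derivative M W D"

end

theory Submission
  imports Defs
begin

text \<open>
  Everything is read off from the coefficient of $\hbar$ in the axioms. Write $x \bullet \tau =
  x\tau + \hbar L_1(x,\tau) + \dots$, $\tau \bullet x = x\tau + \hbar R_1(\tau,x) + \dots$ and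
  $x \bullet y = xy + \hbar B_1(x,y) + \dots$, so that $\gamma(x,\tau) = L_1(x,\tau) - R_1(\tau,x)$
  and $\{x,y\} = B_1(x,y) - B_1(y,x)$. The bimodule axioms become three cocycle-like identities:
  \[ L_1(xy,\tau) + B_1(x,y)\,\tau = x\,L_1(y,\tau) + L_1(x,y\tau), \]
  \[ R_1(\tau,xy) + B_1(x,y)\,\tau = y\,R_1(\tau,x) + R_1(x\tau,y), \]
  \[ R_1(x\tau,y) + y\,L_1(x,\tau) = x\,R_1(\tau,y) + L_1(x,y\tau). \]
  Subtracting the second from the first cancels $B_1$, and the third turns what remains into the
  Leibniz rule for $\gamma(-,\tau)$. Subtracting from the second identity the same identity with
  $x$ and $y$ exchanged leaves $\{x,y\}\,\tau$, because $xy = yx$ classically; combined with the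
  third identity this is the rule for $\gamma(x,y\tau)$. Finally, the $\hbar$-coefficient of
  $\mathrm{d}^\bullet(x \bullet y) = \mathrm{d}^\bullet x \bullet y + x \bullet \mathrm{d}^\bullet y$ is
  \[ \mathrm{d}_1(xy) + \mathrm{d}B_1(x,y) =
       R_1(\mathrm{d}x,y) + y\,\mathrm{d}_1 x + L_1(x,\mathrm{d}y) + x\,\mathrm{d}_1 y, \]
  where $\mathrm{d}_1$ is the first-order part of $\mathrm{d}^\bullet$. All terms with $\mathrm{d}_1$
  are symmetric in $x$ and $y$, so they disappear on antisymmetrising, which gives the
  compatibility of $\gamma$ with the bracket.

  The geometry enters only through the fact that smooth functions and forms are real vector spaces:
  it is what makes $\gamma(x,\tau)$, a difference of two forms, again a form. Closure under
  products follows from the axioms instead, since for example $xy$ is the leading coefficient of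
  $x \bullet y$.
\<close>

section \<open>Smooth functions and forms are real vector spaces\<close>

text \<open>
  A coordinate line through a point of an open \<open>U\<close> stays in \<open>U\<close> for a while; this is why partial
  derivatives at points of \<open>U\<close> depend only on the values on \<open>U\<close>.
\<close>

lemma open_coordinate_line:
  assumes U: "openin (Euclidean_space n) U" and x: "x \<in> U" and i: "i < n"
  shows "open {t. x(i := t) \<in> U}"
proof -
  have x0: "\<forall>j\<ge>n. x j = 0"
    using openin_subset[OF U] x by (auto simp: topspace_Euclidean_space)
  have "continuous_map euclideanreal (Euclidean_space n) (\<lambda>t. x(i := t))"
    unfolding Euclidean_space_def continuous_map_in_subtopology
      continuous_map_componentwise_UNIV
    using x0 i by auto
  from openin_continuous_map_preimage[OF this U] show ?thesis
    by simp
qed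

text \<open>
  The combination is only required to agree with \<open>h\<close> on \<open>U\<close>: off \<open>U\<close>, the partial derivatives of
  \<open>f\<close> and \<open>g\<close> need not exist, and \<^const>\<open>partial_deriv\<close> need not be additive there, so the
  induction could not pass through an equation between functions on the whole space.
\<close>

lemma Ck_on_linear_combination:
  assumes U: "openin (Euclidean_space n) U"
    and "Ck_on n k U f" and "Ck_on n k U g"
    and "\<And>x. x \<in> U \<Longrightarrow> h x = a * f x + b * g x"
  shows "Ck_on n k U h"
  using assms(2-)
proof (induction k arbitrary: f g h)
  case 0
  show ?case
    unfolding Ck_on.simps
  proof (rule continuous_map_eq)
    show "continuous_map (subtopology (Euclidean_space n) U) euclideanreal
        (\<lambda>x. a * f x + b * g x)"
      using 0 by (intro continuous_intros) auto
  qed (simp add: 0(3))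
next
  case (Suc k)
  have deriv: "((\<lambda>t. h (x(i := t))) has_field_derivative
       a * partial_deriv i f x + b * partial_deriv i g x) (at (x i))"
    if i: "i < n" and x: "x \<in> U" for i x
  proof -
    have "(\<lambda>t. f (x(i := t))) field_differentiable at (x i)"
      "(\<lambda>t. g (x(i := t))) field_differentiable at (x i)"
      using Suc.prems(1,2) i x by auto
    then have "((\<lambda>t. f (x(i := t))) has_field_derivative partial_deriv i f x) (at (x i))"
      "((\<lambda>t. g (x(i := t))) has_field_derivative partial_deriv i g x) (at (x i))"
      unfolding partial_deriv_def by (simp_all only: DERIV_deriv_iff_field_differentiable)
    then have "((\<lambda>t. a * f (x(i := t)) + b * g (x(i := t))) has_field_derivative
       a * partial_deriv i f x + b * partial_deriv i g x) (at (x i))"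
      by (intro DERIV_add DERIV_cmult)
    then show ?thesis
    proof (rule has_field_derivative_transform_within_open)
      show "open {t. x(i := t) \<in> U}"
        by (rule open_coordinate_line[OF U x i])
      show "x i \<in> {t. x(i := t) \<in> U}"
        using x by simp
    qed (simp add: Suc.prems(3) del: fun_upd_apply)
  qed
  have "Ck_on n k U (partial_deriv i h)" if i: "i < n" for i
  proof (rule Suc.IH)
    show "Ck_on n k U (partial_deriv i f)" "Ck_on n k U (partial_deriv i g)"
      using Suc.prems(1,2) i by auto
    show "partial_deriv i h x = a * partial_deriv i f x + b * partial_deriv i g x"
      if "x \<in> U" for x
      using DERIV_imp_deriv[OF deriv[OF i that]] by (simp only: partial_deriv_def)
  qed
  moreover have "(\<lambda>t. h (x(i := t))) field_differentiable at (x i)" if "i < n" "x \<in> U" for i x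
    using deriv[OF that] field_differentiable_def by blast
  moreover have "continuous_map (subtopology (Euclidean_space n) U) euclideanreal h"
  proof (rule continuous_map_eq)
    show "continuous_map (subtopology (Euclidean_space n) U) euclideanreal
        (\<lambda>x. a * f x + b * g x)"
      using Suc.prems(1,2) by (intro continuous_intros) auto
  qed (simp add: Suc.prems(3))
  ultimately show ?case
    by simp
qed

lemma C_inf_linear_combination:
  assumes "smooth_manifold M" "f \<in> C_inf M" "g \<in> C_inf M"
  shows "(\<lambda>p. a * f p + b * g p) \<in> C_inf M"
proof -
  have "Ck_on (mdim M) k (\<phi> ` U) (\<lambda>y. a * f (inv_into U \<phi> y) + b * g (inv_into U \<phi> y))"
    if c: "(U, \<phi>) \<in> atlas M" for U \<phi> k
  proof (rule Ck_on_linear_combination)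
    show "openin (Euclidean_space (mdim M)) (\<phi> ` U)"
      using assms(1) c by (auto simp: smooth_manifold_def)
    show "Ck_on (mdim M) k (\<phi> ` U) (\<lambda>y. f (inv_into U \<phi> y))"
      "Ck_on (mdim M) k (\<phi> ` U) (\<lambda>y. g (inv_into U \<phi> y))"
      using assms(2,3) c by (auto simp: C_inf_def smooth_on_def)
  qed simp
  then show ?thesis
    using assms(2,3) by (auto simp: C_inf_def smooth_on_def)
qed

lemma forms_linear_combination:
  assumes M: "smooth_manifold M" and \<omega>: "\<omega> \<in> forms M k" and \<eta>: "\<eta> \<in> forms M k"
  shows "(\<lambda>z. a * \<omega> z + b * \<eta> z) \<in> forms M k"
  unfolding forms_def mem_Collect_eq
proof (intro conjI allI ballI impI)
  fix p vs
  assume "\<not> (p \<in> topspace (points M) \<and> length vs = k \<and> set vs \<subseteq> tangent_space M p)"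
  then show "a * \<omega> (p, vs) + b * \<eta> (p, vs) = 0"
    using \<omega> \<eta> by (simp add: forms_def)
next
  fix p vs i v w c d
  assume "p \<in> topspace (points M)" "length vs = k \<and> set vs \<subseteq> tangent_space M p" "i < k"
    "v \<in> tangent_space M p" "w \<in> tangent_space M p"
  moreover from this have
    "\<omega> (p, vs[i := (\<lambda>f. c * v f + d * w f)]) = c * \<omega> (p, vs[i := v]) + d * \<omega> (p, vs[i := w])"
    using \<omega> unfolding forms_def by blast
  moreover from calculation have
    "\<eta> (p, vs[i := (\<lambda>f. c * v f + d * w f)]) = c * \<eta> (p, vs[i := v]) + d * \<eta> (p, vs[i := w])"
    using \<eta> unfolding forms_def by blast
  ultimately show "a * \<omega> (p, vs[i := (\<lambda>f. c * v f + d * w f)]) +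
        b * \<eta> (p, vs[i := (\<lambda>f. c * v f + d * w f)]) =
      c * (a * \<omega> (p, vs[i := v]) + b * \<eta> (p, vs[i := v])) +
      d * (a * \<omega> (p, vs[i := w]) + b * \<eta> (p, vs[i := w]))"
    by (simp only: algebra_simps)
next
  fix p vs i j
  assume "p \<in> topspace (points M)" "length vs = k \<and> set vs \<subseteq> tangent_space M p" "i < k"
    "j < k" "i \<noteq> j \<and> vs ! i = vs ! j"
  moreover from this have "\<omega> (p, vs) = 0"
    using \<omega> unfolding forms_def by blast
  moreover from calculation have "\<eta> (p, vs) = 0"
    using \<eta> unfolding forms_def by blast
  ultimately show "a * \<omega> (p, vs) + b * \<eta> (p, vs) = 0"
    by simp
next
  fix Xs
  assume "length Xs = k \<and> set Xs \<subseteq> vector_fields M"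
  then show "(\<lambda>p. a * \<omega> (p, map (\<lambda>X. X p) Xs) + b * \<eta> (p, map (\<lambda>X. X p) Xs)) \<in> C_inf M"
    using \<omega> \<eta> by (intro C_inf_linear_combination[OF M]) (auto simp: forms_def)
qed

lemma zero_form_in_forms: "x \<in> C_inf M \<Longrightarrow> zero_form x \<in> forms M 0"
  by (auto simp: forms_def zero_form_def C_inf_def)

section \<open>Coefficients up to first order\<close>

lemma linear_map_zero:
  assumes "linear_map S T F" "u \<in> S"
  shows "F 0 = 0"
proof -
  have "F (\<lambda>z. 0 * u z + 0 * u z) = (\<lambda>z. 0 * F u z + 0 * F u z)"
    using assms unfolding linear_map_def by blast
  then show ?thesis by (simp add: zero_fun_def)
qed

lemma linear_map_diff:
  assumes "linear_map S T F" "u \<in> S" "v \<in> S"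
  shows "F (u - v) = F u - F v"
proof -
  have "F (\<lambda>z. 1 * u z + (- 1) * v z) = (\<lambda>z. 1 * F u z + (- 1) * F v z)"
    using assms unfolding linear_map_def by blast
  then show ?thesis by (simp add: fun_diff_def)
qed

lemma bilinear_map_mem: "bilinear_map S T V F \<Longrightarrow> u \<in> S \<Longrightarrow> v \<in> T \<Longrightarrow> F u v \<in> V"
  by (simp add: bilinear_map_def linear_map_def)

lemma bilinear_map_zero_left: "bilinear_map S T V F \<Longrightarrow> u \<in> S \<Longrightarrow> v \<in> T \<Longrightarrow> F 0 v = 0"
  using linear_map_zero[of S V "\<lambda>u. F u v" u] by (simp add: bilinear_map_def)

lemma bilinear_map_zero_right: "bilinear_map S T V F \<Longrightarrow> u \<in> S \<Longrightarrow> v \<in> T \<Longrightarrow> F u 0 = 0"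
  using linear_map_zero[of T V "F u" v] by (simp add: bilinear_map_def)

lemma happly_order_0: "happly F u 0 = F 0 (u 0)"
  by (simp add: happly_def)

lemma happly_order_1: "happly F u 1 = F 0 (u 1) + F 1 (u 0)"
  by (simp add: happly_def)

lemma happly2_order_0: "happly2 F u v 0 = F 0 (u 0) (v 0)"
  by (simp add: happly2_def)

text \<open>
  The Cauchy product has three terms at order $\hbar$; if one factor is constant in $\hbar$, the term
  with its first-order coefficient is the product with 0. That product vanishes only by linearity on
  the spaces on which the maps are linear, hence the membership of the leading coefficients.
\<close>

lemma happly2_order_1_const_right:
  assumes "bilinear_map S T V (F 0)" "u 0 \<in> S" "v \<in> T"
  shows "happly2 F u (hterm 0 v) 1 = F 0 (u 1) v + F 1 (u 0) v"
proof -
  have "F 0 (u 0) 0 = 0"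
    by (rule bilinear_map_zero_right[OF assms])
  then show ?thesis by (simp add: happly2_def hterm_def)
qed

lemma happly2_order_1_const_left:
  assumes "bilinear_map S T V (F 0)" "u \<in> S" "v 0 \<in> T"
  shows "happly2 F (hterm 0 u) v 1 = F 0 u (v 1) + F 1 u (v 0)"
proof -
  have "F 0 0 (v 0) = 0"
    by (rule bilinear_map_zero_left[OF assms])
  then show ?thesis by (simp add: happly2_def hterm_def)
qed

lemma happly2_order_1_const:
  assumes "bilinear_map S T V (F 0)" "u \<in> S" "v \<in> T"
  shows "happly2 F (hterm 0 u) (hterm 0 v) 1 = F 1 u v"
proof -
  have "F 0 0 v = 0"
    by (rule bilinear_map_zero_left[OF assms])
  then show ?thesis
    using happly2_order_1_const_right[of S T V F "hterm 0 u" v] assms by (simp add: hterm_def)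
qed

lemma eq_mod_hbar_order_0: "eq_mod_hbar 1 u v \<Longrightarrow> u 0 = v 0"
  by (simp add: eq_mod_hbar_def)

lemma eq_mod_hbar_order_1: "eq_mod_hbar 2 u v \<Longrightarrow> u 1 = v 1"
  by (simp add: eq_mod_hbar_def)

section \<open>The first-order part of a deformed calculus\<close>

lemma deformed_product_order_0:
  assumes "deformed_product M B" "x \<in> C_inf M" "y \<in> C_inf M"
  shows "B 0 x y = x * y"
proof -
  have "eq_mod_hbar 1 (happly2 B (hterm 0 x) (hterm 0 y)) (hterm 0 (x * y))"
    using assms by (simp add: deformed_product_def)
  from eq_mod_hbar_order_0[OF this] show ?thesis
    by (simp add: happly2_order_0 hterm_def)
qed

lemma deformed_product_in_C_inf:
  "deformed_product M B \<Longrightarrow> x \<in> C_inf M \<Longrightarrow> y \<in> C_inf M \<Longrightarrow> B n x y \<in> C_inf M"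
  using bilinear_map_mem[of "C_inf M" "C_inf M" "C_inf M" "B n"] by (simp add: deformed_product_def)

lemma deformed_bimodule_order_0:
  assumes "deformed_bimodule M B L R" "x \<in> C_inf M" "\<tau> \<in> forms M 1"
  shows "L 0 x \<tau> = fmult x \<tau>" "R 0 \<tau> x = fmult x \<tau>"
proof -
  have "eq_mod_hbar 1 (happly2 L (hterm 0 x) (hterm 0 \<tau>)) (hterm 0 (fmult x \<tau>))"
    "eq_mod_hbar 1 (happly2 R (hterm 0 \<tau>) (hterm 0 x)) (hterm 0 (fmult x \<tau>))"
    using assms by (simp_all add: deformed_bimodule_def)
  from this[THEN eq_mod_hbar_order_0] show "L 0 x \<tau> = fmult x \<tau>" "R 0 \<tau> x = fmult x \<tau>"
    by (simp_all add: happly2_order_0 hterm_def)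
qed

text \<open>
  Each side of a bimodule axiom is a product of three factors, so its $\hbar$-coefficient has two
  terms, one for each of the two products that may supply the factor $\hbar$; the other product is
  then the classical one.
\<close>

lemma deformed_bimodule_order_1:
  assumes B: "deformed_product M B" and LR: "deformed_bimodule M B L R"
    and x: "x \<in> C_inf M" and y: "y \<in> C_inf M" and \<tau>: "\<tau> \<in> forms M 1"
  shows left_module_order_1:
      "fmult (B 1 x y) \<tau> + L 1 (x * y) \<tau> = fmult x (L 1 y \<tau>) + L 1 x (fmult y \<tau>)" (is ?left)
    and right_module_order_1:
      "fmult (B 1 x y) \<tau> + R 1 \<tau> (x * y) = fmult y (R 1 \<tau> x) + R 1 (fmult x \<tau>) y" (is ?right)
    and middle_associativity_order_1:
      "fmult y (L 1 x \<tau>) + R 1 (fmult x \<tau>) y = fmult x (R 1 \<tau> y) + L 1 x (fmult y \<tau>)" (is ?middle)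
proof -
  note B0 = deformed_product_order_0[OF B] and LR0 = deformed_bimodule_order_0[OF LR]
  have bB: "bilinear_map (C_inf M) (C_inf M) (C_inf M) (B n)"
    and bL: "bilinear_map (C_inf M) (forms M 1) (forms M 1) (L n)"
    and bR: "bilinear_map (forms M 1) (C_inf M) (forms M 1) (R n)" for n
    using B LR by (simp_all add: deformed_product_def deformed_bimodule_def)
  note mem = bilinear_map_mem[OF bB] bilinear_map_mem[OF bL] bilinear_map_mem[OF bR]
  note coeffs = happly2_order_1_const_right[where F = L, OF bL]
    happly2_order_1_const_left[where F = L, OF bL]
    happly2_order_1_const_right[where F = R, OF bR]
    happly2_order_1_const_left[where F = R, OF bR]
    happly2_order_1_const[where F = B, OF bB]
    bilinear_map_zero_left[OF bL x] bilinear_map_zero_right[OF bL _ \<tau>]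
    bilinear_map_zero_left[OF bR \<tau>] bilinear_map_zero_right[OF bR _ x]
  have h: "hterm 0 u 0 = u" "hterm 0 u 1 = 0" for u :: "'z::zero"
    by (simp_all add: hterm_def)
  have
    "eq_mod_hbar 2 (happly2 L (happly2 B (hterm 0 x) (hterm 0 y)) (hterm 0 \<tau>))
                   (happly2 L (hterm 0 x) (happly2 L (hterm 0 y) (hterm 0 \<tau>)))"
    "eq_mod_hbar 2 (happly2 R (hterm 0 \<tau>) (happly2 B (hterm 0 x) (hterm 0 y)))
                   (happly2 R (happly2 R (hterm 0 \<tau>) (hterm 0 x)) (hterm 0 y))"
    "eq_mod_hbar 2 (happly2 R (happly2 L (hterm 0 x) (hterm 0 \<tau>)) (hterm 0 y))
                   (happly2 L (hterm 0 x) (happly2 R (hterm 0 \<tau>) (hterm 0 y)))"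
    using LR x y \<tau> by (simp_all add: deformed_bimodule_def)
  note this[THEN eq_mod_hbar_order_1]
  moreover have "fmult x \<tau> \<in> forms M 1" "fmult y \<tau> \<in> forms M 1" "x * y \<in> C_inf M"
    using mem(1)[OF x y, of 0] mem(2)[OF x \<tau>, of 0] mem(2)[OF y \<tau>, of 0]
    by (simp_all del: One_nat_def add: B0 LR0 x y \<tau>)
  ultimately show ?left ?right ?middle
    using x y \<tau> mem
    by (simp_all del: One_nat_def add: coeffs happly2_order_0 h B0 LR0)
qed

lemma deformed_derivative_order_0:
  assumes "deformed_derivative M W D" "\<xi> \<in> forms M p"
  shows "D p 0 \<xi> = ext_deriv M p \<xi>"
proof -
  have "eq_mod_hbar 1 (happly (D p) (hterm 0 \<xi>)) (hterm 0 (ext_deriv M p \<xi>))"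
    using assms by (simp add: deformed_derivative_def)
  from eq_mod_hbar_order_0[OF this] show ?thesis
    by (simp add: happly_order_0 hterm_def)
qed

text \<open>
  Functions enter the exterior algebra as 0-forms, so the $\hbar$-coefficient of the graded Leibniz
  rule for two of them involves no wedge product other than those of functions and 1-forms, which
  \<open>B\<close>, \<open>L\<close> and \<open>R\<close> determine.
\<close>

lemma deformed_derivative_order_1:
  assumes B: "deformed_product M B" and LR: "deformed_bimodule M B L R"
    and W: "deformed_wedge M B L R W" and D: "deformed_derivative M W D"
    and x: "x \<in> C_inf M" and y: "y \<in> C_inf M"
  shows "ext_deriv M 0 (zero_form (B 1 x y)) + D 0 1 (zero_form (x * y)) =
    (fmult y (D 0 1 (zero_form x)) + R 1 (ext_deriv M 0 (zero_form x)) y) +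
    (fmult x (D 0 1 (zero_form y)) + L 1 x (ext_deriv M 0 (zero_form y)))"
proof -
  note B0 = deformed_product_order_0[OF B] and LR0 = deformed_bimodule_order_0[OF LR]
  note Bmem = deformed_product_in_C_inf[OF B]
  have lD: "linear_map (forms M 0) (forms M 1) (D 0 n)" for n
    using D by (auto simp: deformed_derivative_def)
  have bW: "bilinear_map (forms M p) (forms M q) (forms M (p + q)) (W p q n)" for p q n
    using W by (simp add: deformed_wedge_def)
  have bW00: "bilinear_map (forms M 0) (forms M 0) (forms M 0) (W 0 0 n)"
    and bW01: "bilinear_map (forms M 0) (forms M 1) (forms M 1) (W 0 1 n)"
    and bW10: "bilinear_map (forms M 1) (forms M 0) (forms M 1) (W 1 0 n)" for n
    using bW[of 0 0 n] bW[of 0 1 n] bW[of 1 0 n] by simp_all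
  note D0 = deformed_derivative_order_0[OF D]
  have W00: "W 0 0 n (zero_form u) (zero_form v) = zero_form (B n u v)"
    if "u \<in> C_inf M" "v \<in> C_inf M" for n u v
    using W that by (simp add: deformed_wedge_def)
  have W01: "W 0 1 n (zero_form u) \<tau> = L n u \<tau>" and W10: "W 1 0 n \<tau> (zero_form u) = R n \<tau> u"
    if "u \<in> C_inf M" "\<tau> \<in> forms M 1" for n u \<tau>
    using W that by (simp_all add: deformed_wedge_def)
  have Dmem: "D 0 n \<xi> \<in> forms M 1" if "\<xi> \<in> forms M 0" for n \<xi>
    using lD[of n] that by (simp add: linear_map_def)
  have dmem: "ext_deriv M 0 \<xi> \<in> forms M 1" if "\<xi> \<in> forms M 0" for \<xi>
    using Dmem[OF that, of 0] D0[OF that] by simp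
  have h0: "hterm 0 u 0 = u" for u :: "'z::zero"
    by (simp add: hterm_def)
  have D1: "happly (D 0) (hterm 0 \<xi>) 1 = D 0 1 \<xi>" if "\<xi> \<in> forms M 0" for \<xi>
    unfolding happly_order_1 using linear_map_zero[OF lD that, of 0] by (simp add: hterm_def)
  note zx = zero_form_in_forms[OF x] and zy = zero_form_in_forms[OF y]
  let ?x = "hterm 0 (zero_form x)" and ?y = "hterm 0 (zero_form y)"
  have "eq_mod_hbar 2 (happly (D (0 + 0)) (happly2 (W 0 0) ?x ?y))
      (happly2 (W (Suc 0) 0) (happly (D 0) ?x) ?y +
       (-1) ^ 0 * happly2 (W 0 (Suc 0)) ?x (happly (D 0) ?y))"
    using D zx zy unfolding deformed_derivative_def by blast
  then have "happly (D 0) (happly2 (W 0 0) ?x ?y) 1 =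
      happly2 (W 1 0) (happly (D 0) ?x) ?y 1 + happly2 (W 0 1) ?x (happly (D 0) ?y) 1"
    by (auto dest: eq_mod_hbar_order_1)
  moreover have "happly (D 0) (happly2 (W 0 0) ?x ?y) 1 =
      ext_deriv M 0 (zero_form (B 1 x y)) + D 0 1 (zero_form (x * y))"
    unfolding happly_order_1 happly2_order_0 h0
      happly2_order_1_const[where F = "W 0 0", OF bW00 zx zy]
    using Bmem[OF x y] by (simp add: W00[OF x y] B0[OF x y] D0 zero_form_in_forms)
  moreover have "happly2 (W 1 0) (happly (D 0) ?x) ?y 1 =
      fmult y (D 0 1 (zero_form x)) + R 1 (ext_deriv M 0 (zero_form x)) y"
  proof -
    have "happly (D 0) ?x 0 = ext_deriv M 0 (zero_form x)"
      by (simp add: happly_order_0 h0 D0[OF zx])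
    then show ?thesis
      using happly2_order_1_const_right[where F = "W 1 0", OF bW10 _ zy, of "happly (D 0) ?x"]
        W10[OF y Dmem[OF zx]] W10[OF y dmem[OF zx]] LR0(2)[OF y Dmem[OF zx]]
      by (simp del: One_nat_def add: D1[OF zx] dmem[OF zx])
  qed
  moreover have "happly2 (W 0 1) ?x (happly (D 0) ?y) 1 =
      fmult x (D 0 1 (zero_form y)) + L 1 x (ext_deriv M 0 (zero_form y))"
  proof -
    have "happly (D 0) ?y 0 = ext_deriv M 0 (zero_form y)"
      by (simp add: happly_order_0 h0 D0[OF zy])
    then show ?thesis
      using happly2_order_1_const_left[where F = "W 0 1", OF bW01 zx, of "happly (D 0) ?y"]
        W01[OF x Dmem[OF zy]] W01[OF x dmem[OF zy]] LR0(1)[OF x Dmem[OF zy]]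
      by (simp del: One_nat_def add: D1[OF zy] dmem[OF zy])
  qed
  ultimately show ?thesis by simp
qed

text \<open>
  On functions the exterior derivative is the leading coefficient of a series of linear maps, so its
  linearity and the smoothness of $\mathrm{d}x$ need no computation with vector fields.
\<close>

lemma ext_deriv_zero_form:
  assumes D: "deformed_derivative M W D"
  shows ext_deriv_zero_form_in_forms: "x \<in> C_inf M \<Longrightarrow> ext_deriv M 0 (zero_form x) \<in> forms M 1"
    and ext_deriv_zero_form_diff: "x \<in> C_inf M \<Longrightarrow> y \<in> C_inf M \<Longrightarrow> x - y \<in> C_inf M \<Longrightarrow>
      ext_deriv M 0 (zero_form (x - y)) = ext_deriv M 0 (zero_form x) - ext_deriv M 0 (zero_form y)"
proof -
  have lD: "linear_map (forms M 0) (forms M 1) (D 0 0)"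
    using D by (auto simp: deformed_derivative_def)
  have D0: "D 0 0 (zero_form u) = ext_deriv M 0 (zero_form u)" if "u \<in> C_inf M" for u
    by (rule deformed_derivative_order_0[OF D zero_form_in_forms[OF that]])
  show "ext_deriv M 0 (zero_form x) \<in> forms M 1" if "x \<in> C_inf M"
    using lD D0[OF that] zero_form_in_forms[OF that] by (auto simp: linear_map_def)
  have "zero_form (x - y) = zero_form x - zero_form y"
    by (auto simp: zero_form_def)
  then have "D 0 0 (zero_form (x - y)) = D 0 0 (zero_form x) - D 0 0 (zero_form y)"
    if "x \<in> C_inf M" "y \<in> C_inf M"
    using linear_map_diff[OF lD zero_form_in_forms[OF that(1)] zero_form_in_forms[OF that(2)]]
    by simp
  then show "ext_deriv M 0 (zero_form (x - y)) =
      ext_deriv M 0 (zero_form x) - ext_deriv M 0 (zero_form y)"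
    if "x \<in> C_inf M" "y \<in> C_inf M" "x - y \<in> C_inf M"
    using that by (simp only: D0)
qed

section \<open>The semiclassical data of a deformed calculus\<close>

theorem proposition2p1:
  fixes M :: "'a manifold"
    and B :: "(('a \<Rightarrow> real) \<Rightarrow> ('a \<Rightarrow> real) \<Rightarrow> 'a \<Rightarrow> real) series"
    and L :: "(('a \<Rightarrow> real) \<Rightarrow> 'a form \<Rightarrow> 'a form) series"
    and R :: "('a form \<Rightarrow> ('a \<Rightarrow> real) \<Rightarrow> 'a form) series"
    and W :: "nat \<Rightarrow> nat \<Rightarrow> ('a form \<Rightarrow> 'a form \<Rightarrow> 'a form) series"
    and D :: "nat \<Rightarrow> ('a form \<Rightarrow> 'a form) series"
    and pb :: "('a \<Rightarrow> real) \<Rightarrow> ('a \<Rightarrow> real) \<Rightarrow> 'a \<Rightarrow> real"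
    and \<gamma> :: "('a \<Rightarrow> real) \<Rightarrow> 'a form \<Rightarrow> 'a form"
  assumes "smooth_manifold M"
    and "formal_deformation M B L R W D"
    and "\<And>x y. x \<in> C_inf M \<Longrightarrow> y \<in> C_inf M \<Longrightarrow>
           eq_mod_hbar 2 (happly2 B (hterm 0 x) (hterm 0 y) - happly2 B (hterm 0 y) (hterm 0 x))
                         (hterm 1 (pb x y))"
    and "\<And>x \<tau>. x \<in> C_inf M \<Longrightarrow> \<tau> \<in> forms M 1 \<Longrightarrow>
           eq_mod_hbar 2 (happly2 L (hterm 0 x) (hterm 0 \<tau>) - happly2 R (hterm 0 \<tau>) (hterm 0 x))
                         (hterm 1 (\<gamma> x \<tau>))"
  shows "(\<forall>\<tau>\<in>forms M 1.
            linear_map (C_inf M) (forms M 1) (\<lambda>x. \<gamma> x \<tau>) \<and>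
            (\<forall>x\<in>C_inf M. \<forall>y\<in>C_inf M. \<gamma> (x * y) \<tau> = fmult x (\<gamma> y \<tau>) + fmult y (\<gamma> x \<tau>))) \<and>
         (\<forall>x\<in>C_inf M. \<forall>y\<in>C_inf M. \<forall>\<tau>\<in>forms M 1.
            \<gamma> x (fmult y \<tau>) = fmult y (\<gamma> x \<tau>) + fmult (pb x y) \<tau>) \<and>
         (\<forall>x\<in>C_inf M. \<forall>y\<in>C_inf M.
            ext_deriv M 0 (zero_form (pb x y)) =
              \<gamma> x (ext_deriv M 0 (zero_form y)) - \<gamma> y (ext_deriv M 0 (zero_form x)))"
proof -
  have B: "deformed_product M B" and LR: "deformed_bimodule M B L R"
    and W: "deformed_wedge M B L R W" and D: "deformed_derivative M W D"
    using assms(2) by (simp_all add: formal_deformation_def)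
  have bB: "bilinear_map (C_inf M) (C_inf M) (C_inf M) (B n)"
    and bL: "bilinear_map (C_inf M) (forms M 1) (forms M 1) (L n)"
    and bR: "bilinear_map (forms M 1) (C_inf M) (forms M 1) (R n)" for n
    using B LR by (simp_all add: deformed_product_def deformed_bimodule_def)
  have pb: "pb x y = B 1 x y - B 1 y x" if "x \<in> C_inf M" "y \<in> C_inf M" for x y
    using eq_mod_hbar_order_1[OF assms(3)[OF that]]
      happly2_order_1_const[where F = B, OF bB that]
      happly2_order_1_const[where F = B, OF bB that(2) that(1)]
    by (simp add: hterm_def)
  have \<gamma>: "\<gamma> x \<tau> = L 1 x \<tau> - R 1 \<tau> x" if "x \<in> C_inf M" "\<tau> \<in> forms M 1" for x \<tau>
    using eq_mod_hbar_order_1[OF assms(4)[OF that]]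
      happly2_order_1_const[where F = L, OF bL that]
      happly2_order_1_const[where F = R, OF bR that(2) that(1)]
    by (simp add: hterm_def)
  have prod: "x * y \<in> C_inf M" if "x \<in> C_inf M" "y \<in> C_inf M" for x y
    using bilinear_map_mem[OF bB that, of 0] deformed_product_order_0[OF B that] by simp
  have fmult: "fmult x \<tau> \<in> forms M 1" if "x \<in> C_inf M" "\<tau> \<in> forms M 1" for x \<tau>
    using bilinear_map_mem[OF bL that, of 0] deformed_bimodule_order_0(1)[OF LR that] by simp
  have linear: "linear_map (C_inf M) (forms M 1) (\<lambda>x. \<gamma> x \<tau>)" if \<tau>: "\<tau> \<in> forms M 1" for \<tau>
    unfolding linear_map_def
  proof (intro conjI ballI allI)
    fix x assume x: "x \<in> C_inf M"
    have "(\<lambda>z. 1 * L 1 x \<tau> z + (- 1) * R 1 \<tau> x z) \<in> forms M 1"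
      by (intro forms_linear_combination[OF assms(1)] bilinear_map_mem[OF bL] bilinear_map_mem[OF bR] x \<tau>)
    then show "\<gamma> x \<tau> \<in> forms M 1"
      by (simp add: \<gamma>[OF x \<tau>] fun_diff_def)
  next
    fix x y a b assume x: "x \<in> C_inf M" and y: "y \<in> C_inf M"
    have "L 1 (\<lambda>z. a * x z + b * y z) \<tau> = (\<lambda>z. a * L 1 x \<tau> z + b * L 1 y \<tau> z)"
      using bL[of 1] x y \<tau> unfolding bilinear_map_def linear_map_def by blast
    moreover have "R 1 \<tau> (\<lambda>z. a * x z + b * y z) = (\<lambda>z. a * R 1 \<tau> x z + b * R 1 \<tau> y z)"
      using bR[of 1] x y \<tau> unfolding bilinear_map_def linear_map_def by blast
    ultimately show "\<gamma> (\<lambda>z. a * x z + b * y z) \<tau> = (\<lambda>z. a * \<gamma> x \<tau> z + b * \<gamma> y \<tau> z)"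
      using x y \<tau> C_inf_linear_combination[OF assms(1) x y, of a b]
      by (simp add: \<gamma> fun_eq_iff algebra_simps)
  qed
  have fmult_diff_right: "fmult x (\<omega> - \<eta>) = fmult x \<omega> - fmult x \<eta>"
    and fmult_diff_left: "fmult (x - y) \<omega> = fmult x \<omega> - fmult y \<omega>" for x y and \<omega> \<eta> :: "'a form"
    by (auto simp: fmult_def algebra_simps)
  have leibniz: "\<gamma> (x * y) \<tau> = fmult x (\<gamma> y \<tau>) + fmult y (\<gamma> x \<tau>)"
    if x: "x \<in> C_inf M" and y: "y \<in> C_inf M" and \<tau>: "\<tau> \<in> forms M 1" for x y \<tau>
  proof (rule ext)
    fix z
    show "\<gamma> (x * y) \<tau> z = (fmult x (\<gamma> y \<tau>) + fmult y (\<gamma> x \<tau>)) z"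
      unfolding \<gamma>[OF prod[OF x y] \<tau>] \<gamma>[OF x \<tau>] \<gamma>[OF y \<tau>] fmult_diff_right
      using deformed_bimodule_order_1[OF B LR x y \<tau>, THEN fun_cong, of z]
      unfolding plus_fun_apply minus_apply by linarith
  qed
  (* The cocycle identity for R is used for (x, y) and for (y, x); rewriting y * x to x * y makes the
     terms R 1 \<tau> (x * y) equal, so that only the bracket and terms of the middle identity remain. *)
  have connection: "\<gamma> x (fmult y \<tau>) = fmult y (\<gamma> x \<tau>) + fmult (pb x y) \<tau>"
    if x: "x \<in> C_inf M" and y: "y \<in> C_inf M" and \<tau>: "\<tau> \<in> forms M 1" for x y \<tau>
  proof (rule ext)
    fix z
    show "\<gamma> x (fmult y \<tau>) z = (fmult y (\<gamma> x \<tau>) + fmult (pb x y) \<tau>) z"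
      unfolding \<gamma>[OF x fmult[OF y \<tau>]] \<gamma>[OF x \<tau>] pb[OF x y] fmult_diff_right fmult_diff_left
      using middle_associativity_order_1[OF B LR x y \<tau>, THEN fun_cong, of z]
        right_module_order_1[OF B LR x y \<tau>, THEN fun_cong, of z]
        right_module_order_1[OF B LR y x \<tau>, unfolded mult.commute[of y x], THEN fun_cong, of z]
      unfolding plus_fun_apply minus_apply by linarith
  qed
  have compatible: "ext_deriv M 0 (zero_form (pb x y)) =
      \<gamma> x (ext_deriv M 0 (zero_form y)) - \<gamma> y (ext_deriv M 0 (zero_form x))"
    if x: "x \<in> C_inf M" and y: "y \<in> C_inf M" for x y
  proof -
    note Bxy = deformed_product_in_C_inf[OF B x y, of 1]
      and Byx = deformed_product_in_C_inf[OF B y x, of 1]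
    have "B 1 x y - B 1 y x \<in> C_inf M"
      using C_inf_linear_combination[OF assms(1) Bxy Byx, of 1 "- 1"] by (simp add: fun_diff_def)
    then have "ext_deriv M 0 (zero_form (pb x y)) =
        ext_deriv M 0 (zero_form (B 1 x y)) - ext_deriv M 0 (zero_form (B 1 y x))"
      unfolding pb[OF x y] using ext_deriv_zero_form_diff[OF D Bxy Byx] by simp
    (* Rewriting y * x to x * y lets the terms D 0 1 (zero_form (x * y)) cancel; the other terms with
       D 0 1 are exchanged by the swap of x and y. *)
    moreover have "(ext_deriv M 0 (zero_form (B 1 x y)) - ext_deriv M 0 (zero_form (B 1 y x))) z =
        (\<gamma> x (ext_deriv M 0 (zero_form y)) - \<gamma> y (ext_deriv M 0 (zero_form x))) z" for z
      unfolding \<gamma>[OF x ext_deriv_zero_form_in_forms[OF D y]]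
        \<gamma>[OF y ext_deriv_zero_form_in_forms[OF D x]]
      using deformed_derivative_order_1[OF B LR W D x y, THEN fun_cong, of z]
        deformed_derivative_order_1[OF B LR W D y x, unfolded mult.commute[of y x],
          THEN fun_cong, of z]
      unfolding plus_fun_apply minus_apply by linarith
    ultimately show ?thesis
      by (simp add: fun_eq_iff)
  qed
  show ?thesis
    using linear leibniz connection compatible by blast
qed

end
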